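(* For each $p\in(1,\infty)$, the Banach space $c_0$ is finitely representable in the $p^{\text{th}}$ James space $J_p$.
   Context: Let $\mathbb{K}=\mathbb{R}$ or $\mathbb{K}=\mathbb{C}$ be the scalar field. Write $\mathbb{N}_0$ and $\mathbb{N}$ for the sets of non-negative and positive integers, respectively; sequences are indexed by $\mathbb{N}_0$, and $x(n)$ denotes the $n^{\text{th}}$ element of the sequence $x$. For $p\in(1,\infty)$ and a scalar sequence $x\in\mathbb{K}^{\mathbb{N}_0}$, put \[ \|x\|_{J_p} = \sup\biggl\{ \Bigl(\sum_{j=1}^k | x(n_j) - x(n_{j+1})|^p\Bigr)^{1/p} : k\in\mathbb{N},\ n_1,\ldots,n_{k+1}\in \mathbb{N}_0,\ n_1 <\cdots < n_{k+1}\biggr\}. \] The $p^{\text{th}}$ James space is the Banach space $J_p = \{ x\in c_0 : \| x\|_{J_p} < \infty\}$ with the norm $\|\cdot\|_{J_p}$. A Banach space $X$ is finitely representable in a Banach space $Y$ if, for each finite-dimensional subspace $F$ of $X$ and each $\varepsilon>0$, there is a linear operator $T\colon F\to Y$ such that $(1-\varepsilon)\|x\|_X\leq\|Tx\|_Y\leq (1+\varepsilon)\|x\|_X$ for all $x\in F$. Here $c_0$ is the space of null sequences in $\mathbb{K}$ with the supremum norm. *)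

theory Defs
  imports "HOL-Analysis.Analysis" "HOL-Library.Function_Algebras"
begin

text \<open>
  Normed spaces over the scalar field \<open>'k\<close> are given by a carrier, a scalar multiplication and a
  norm, because the carrier of the James space depends on the real parameter \<open>p\<close> and hence cannot
  be a type. Vector addition is that of the ambient type; for sequences this is the pointwise
  addition of \<^theory>\<open>HOL-Library.Function_Algebras\<close>.
\<close>

record ('k, 'v) nspace =
  ns_carrier :: "'v set"
  ns_scale :: "'k \<Rightarrow> 'v \<Rightarrow> 'v"
  ns_norm :: "'v \<Rightarrow> real"

definition findim_subspace :: "('k::field, 'v::ab_group_add) nspace \<Rightarrow> 'v set \<Rightarrow> bool" where
  "findim_subspace X F \<longleftrightarrow>
     F \<subseteq> ns_carrier X \<and> module.subspace (ns_scale X) F \<and>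
     (\<exists>B. finite B \<and> F = module.span (ns_scale X) B)"

definition linear_operator_on ::
  "'v set \<Rightarrow> ('k::field, 'v::ab_group_add) nspace \<Rightarrow> ('k, 'w::ab_group_add) nspace \<Rightarrow> ('v \<Rightarrow> 'w) \<Rightarrow> bool"
where
  "linear_operator_on F X Y T \<longleftrightarrow>
     (\<forall>x\<in>F. T x \<in> ns_carrier Y) \<and>
     (\<forall>x\<in>F. \<forall>y\<in>F. T (x + y) = T x + T y) \<and>
     (\<forall>c. \<forall>x\<in>F. T (ns_scale X c x) = ns_scale Y c (T x))"

definition finitely_representable ::
  "('k::field, 'v::ab_group_add) nspace \<Rightarrow> ('k, 'w::ab_group_add) nspace \<Rightarrow> bool"
where
  "finitely_representable X Y \<longleftrightarrow>
     (\<forall>F \<epsilon>. findim_subspace X F \<and> \<epsilon> > 0 \<longrightarrow>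
        (\<exists>T. linear_operator_on F X Y T \<and>
             (\<forall>x\<in>F. (1 - \<epsilon>) * ns_norm X x \<le> ns_norm Y (T x) \<and>
                     ns_norm Y (T x) \<le> (1 + \<epsilon>) * ns_norm X x)))"

definition seq_scale :: "'k::times \<Rightarrow> (nat \<Rightarrow> 'k) \<Rightarrow> nat \<Rightarrow> 'k" where
  "seq_scale c x = (\<lambda>n. c * x n)"

interpretation seq: vector_space "seq_scale :: 'k::field \<Rightarrow> _"
  by unfold_locales (auto simp: seq_scale_def fun_eq_iff algebra_simps)

definition c0_space :: "('k::real_normed_field, nat \<Rightarrow> 'k) nspace" where
  "c0_space = \<lparr> ns_carrier = {x. x \<longlonglongrightarrow> 0},
                ns_scale = seq_scale,
                ns_norm = (\<lambda>x. SUP n. norm (x n)) \<rparr>"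

text \<open>
  The supremum is taken in \<^typ>\<open>ennreal\<close>, where it may be infinite. Only the values of \<open>n\<close>
  on \<open>{1..k + 1}\<close> matter.
\<close>

definition james_enorm :: "real \<Rightarrow> (nat \<Rightarrow> 'k::real_normed_field) \<Rightarrow> ennreal" where
  "james_enorm p x =
     Sup {ennreal ((\<Sum>j = 1..k. norm (x (n j) - x (n (j + 1))) powr p) powr (1 / p)) | k n.
            k \<ge> 1 \<and> strict_mono_on {1..k + 1} (n :: nat \<Rightarrow> nat)}"

definition james_space :: "real \<Rightarrow> ('k::real_normed_field, nat \<Rightarrow> 'k) nspace" where
  "james_space p = \<lparr> ns_carrier = {x \<in> ns_carrier c0_space. james_enorm p x < \<infinity>},
                     ns_scale = seq_scale,
                     ns_norm = (\<lambda>x. enn2real (james_enorm p x)) \<rparr>"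

end

theory Submission
  imports Defs
begin

text \<open>
  Two facts combine. On a finite-dimensional subspace \<open>F\<close> of \<open>c\<^sub>0\<close> the norm is the maximum of the
  moduli of the first \<open>m\<close> terms, for one \<open>m\<close> that serves all of \<open>F\<close>
  (\<open>findim_c0_sup_attained_early\<close>). Hence it is enough to find, for each \<open>m\<close> and \<open>\<epsilon>\<close>, real
  sequences \<open>u\<^sub>0, \<dots>, u\<^sub>m\<^sub>-\<^sub>1\<close> in \<open>J\<^sub>p\<close> that span an almost isometric copy of the
  \<open>m\<close>-dimensional \<open>\<ell>\<^sub>\<infinity>\<close>, and to let \<open>T x\<close> be the sum of the \<open>x\<^sub>i u\<^sub>i\<close>.
  
  Take for \<open>u\<^sub>i\<close> a triangle wave on \<open>{0..N}\<close>, where \<open>N = q\<^sup>m\<close>, with half period \<open>L\<^sub>i = q\<^sup>i\<close> and with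
  amplitude \<open>(L\<^sub>i/N)\<^sup>1\<^sup>/\<^sup>p\<close>. This amplitude makes the \<open>N/L\<^sub>i\<close> jumps between consecutive extrema
  contribute \<open>1\<close> in total to the \<open>p\<close>-th power of the norm. The increment of \<open>u\<^sub>i\<close> over a distance
  \<open>d\<close> is at most \<open>(d/N)\<^sup>1\<^sup>/\<^sup>p\<close> times \<open>min (t\<^sup>1\<^sup>-\<^sup>1\<^sup>/\<^sup>p) (t\<^sup>-\<^sup>1\<^sup>/\<^sup>p)\<close> with \<open>t = d/L\<^sub>i\<close>. Because \<open>p > 1\<close>,
  this factor decays in both directions away from \<open>L\<^sub>i = d\<close>; so, if \<open>q\<close> is large, at each scale
  \<open>d\<close> the factors of all waves together add up to at most \<open>1 + \<epsilon>\<close>. That is a Hoelder condition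
  with exponent \<open>1/p\<close> (\<open>lacunary_waves_hoelder\<close>).
  
  It gives both estimates. If all coefficients are bounded by \<open>M\<close>, then the combination is Hoelder
  with constant \<open>(1 + \<epsilon>) M\<close>, which bounds its \<open>p\<close>-variation. Conversely, if the \<open>i\<close>-th coefficient
  has modulus \<open>M\<close>, test the norm on the extrema of \<open>u\<^sub>i\<close>: at distance \<open>d = L\<^sub>i\<close> the wave \<open>u\<^sub>i\<close> uses up
  the share \<open>1\<close> of the bound \<open>1 + \<epsilon>\<close>, so that the other waves can spoil at most \<open>\<epsilon> M\<close>.
\<close>

section \<open>Finite-dimensional subspaces of \<open>c\<^sub>0\<close>\<close>

text \<open>
  The coefficients that represent \<open>x\<close> here are themselves terms of \<open>x\<close>, hence bounded by its
  norm; linear algebra thus takes the place of a compactness argument on the unit sphere.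
  The proof is Gaussian elimination: when a vector \<open>v\<close> is added, its
  interpolation defect \<open>w\<close> either vanishes or is nonzero at some place \<open>j\<close>, and in the second case
  the term with index \<open>j\<close> determines the multiple of \<open>w\<close> that has to be added.
\<close>

lemma span_interpolation:
  fixes B :: "(nat \<Rightarrow> 'k::real_normed_field) set"
  assumes "finite B" and "\<And>v. v \<in> B \<Longrightarrow> v \<longlonglongrightarrow> 0"
  shows "\<exists>m b. (\<forall>i<m. b i \<longlonglongrightarrow> 0) \<and> (\<forall>x\<in>seq.span B. \<forall>n. x n = (\<Sum>i<m. x i * b i n))"
  using assms
proof (induction B rule: finite_induct)
  case empty
  show ?case by (rule exI[of _ 0]) auto
next
  case (insert v B)
  have "\<exists>m b. (\<forall>i<m. b i \<longlonglongrightarrow> 0) \<and> (\<forall>x\<in>seq.span B. \<forall>n. x n = (\<Sum>i<m. x i * b i n))"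
    by (rule insert.IH) (use insert.prems in blast)
  then obtain m :: nat and b :: "nat \<Rightarrow> nat \<Rightarrow> 'k"
    where mb: "(\<forall>i<m. b i \<longlonglongrightarrow> 0) \<and> (\<forall>x\<in>seq.span B. \<forall>n. x n = (\<Sum>i<m. x i * b i n))"
    by (elim exE that)
  have b0: "b i \<longlonglongrightarrow> 0" if "i < m" for i
    using conjunct1[OF mb] that by simp
  have b: "x n = (\<Sum>i<m. x i * b i n)" if "x \<in> seq.span B" for x n
    using bspec[OF conjunct2[OF mb] that] by (rule spec)
  define w where "w n = v n - (\<Sum>i<m. v i * b i n)" for n
  have w0: "w \<longlonglongrightarrow> 0"
  proof -
    have "(\<lambda>n. v n - (\<Sum>i<m. v i * b i n)) \<longlonglongrightarrow> 0 - (\<Sum>i<m. v i * 0)"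
      by (intro tendsto_intros b0) (use insert.prems in auto)
    then show ?thesis by (simp add: w_def[abs_def])
  qed
  have defect: "\<exists>k. \<forall>n. x n - (\<Sum>i<m. x i * b i n) = k * w n"
    if x: "x \<in> seq.span (insert v B)" for x
  proof -
    obtain k where k: "x - seq_scale k v \<in> seq.span B"
      using x seq.span_breakdown_eq by blast
    have "x n - (\<Sum>i<m. x i * b i n) = k * w n" for n
    proof -
      have "x n - k * v n = (\<Sum>i<m. (x i - k * v i) * b i n)"
        using b[OF k, of n] by (simp add: seq_scale_def)
      also have "\<dots> = (\<Sum>i<m. x i * b i n) - k * (\<Sum>i<m. v i * b i n)"
        by (simp add: algebra_simps sum_subtractf sum_distrib_left)
      finally show ?thesis by (simp add: w_def algebra_simps)
    qed
    then show ?thesis by blast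
  qed
  show ?case
  proof (cases "\<forall>n. w n = 0")
    case True
    then have "\<forall>x\<in>seq.span (insert v B). \<forall>n. x n = (\<Sum>i<m. x i * b i n)"
      using defect by fastforce
    with b0 show ?thesis by blast
  next
    case False
    then obtain j where j: "w j \<noteq> 0" by blast
    define e where "e n = w n / w j" for n
    have e0: "e \<longlonglongrightarrow> 0"
      using tendsto_divide[OF w0 tendsto_const j] by (simp add: e_def[abs_def])
    \<comment> \<open>The new \<open>b'\<close> first interpolates by \<open>b\<close> and then corrects the error at \<open>j\<close> by a multiple of \<open>e\<close>, as \<open>e j = 1\<close>.\<close>
    define m' where "m' = max m (Suc j)"
    define b1 where "b1 i n = (if i < m then b i n else 0)" for i n
    define b' where "b' i n = b1 i n - b1 i j * e n + (if i = j then e n else 0)" for i n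
    have b1_0: "b1 i \<longlonglongrightarrow> 0" for i
      by (cases "i < m") (auto simp: b1_def[abs_def] b0)
    have b'0: "b' i \<longlonglongrightarrow> 0" for i
    proof -
      have spike: "(\<lambda>n. if i = j then e n else 0) \<longlonglongrightarrow> 0"
        by (cases "i = j") (simp_all add: e0)
      have "(\<lambda>n. b1 i n - b1 i j * e n + (if i = j then e n else 0)) \<longlonglongrightarrow> 0 - b1 i j * 0 + 0"
        by (intro tendsto_intros b1_0 e0 spike)
      then show ?thesis by (simp add: b'_def[abs_def])
    qed
    have "x n = (\<Sum>i<m'. x i * b' i n)" if x: "x \<in> seq.span (insert v B)" for x n
    proof -
      obtain k where k: "\<And>n. x n - (\<Sum>i<m. x i * b i n) = k * w n"
        using defect[OF x] by blast
      have jm': "j < m'" by (simp add: m'_def)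
      have b1s: "(\<Sum>i<m'. x i * b1 i n) = (\<Sum>i<m. x i * b i n)" for n
        by (rule sum.mono_neutral_cong_right) (auto simp: m'_def b1_def)
      have "(\<Sum>i<m'. x i * b' i n)
          = (\<Sum>i<m'. x i * b1 i n) - (\<Sum>i<m'. x i * b1 i j) * e n
            + (\<Sum>i<m'. if i = j then x i * e n else 0)"
        unfolding sum_distrib_right sum_subtractf[symmetric] sum.distrib[symmetric]
        by (rule sum.cong) (auto simp: b'_def algebra_simps)
      also have "\<dots> = (\<Sum>i<m. x i * b i n) + (x j - (\<Sum>i<m. x i * b i j)) * e n"
        using jm' by (simp add: b1s algebra_simps)
      also have "\<dots> = (\<Sum>i<m. x i * b i n) + k * w n"
        using j by (simp add: k e_def)
      also have "\<dots> = x n" using k[of n] by (simp add: algebra_simps)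
      finally show ?thesis by simp
    qed
    with b'0 show ?thesis by blast
  qed
qed

text \<open>
  By \<open>span_interpolation\<close>, a late term \<open>x n\<close> is a combination of early terms of \<open>x\<close>, with
  coefficients \<open>b i n\<close> that do not depend on \<open>x\<close> and that are small for large \<open>n\<close>.
\<close>

lemma findim_c0_sup_attained_early:
  fixes F :: "(nat \<Rightarrow> 'k::real_normed_field) set"
  assumes "findim_subspace c0_space F"
  shows "\<exists>m. \<forall>x\<in>F. \<forall>n. \<exists>i<m. norm (x n) \<le> norm (x i)"
proof -
  have F0: "F \<subseteq> {x. x \<longlonglongrightarrow> 0}" and "\<exists>B. finite B \<and> F = seq.span B"
    using assms by (simp_all add: findim_subspace_def c0_space_def)
  then obtain B where B: "finite B" "F = seq.span B" by (elim exE conjE)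
  have "\<exists>m b. (\<forall>i<m. b i \<longlonglongrightarrow> 0) \<and> (\<forall>x\<in>seq.span B. \<forall>n. x n = (\<Sum>i<m. x i * b i n))"
  proof (rule span_interpolation[OF B(1)])
    show "v \<longlonglongrightarrow> 0" if "v \<in> B" for v
    proof -
      have "v \<in> F" unfolding B(2) using that by (rule seq.span_base)
      with F0 show ?thesis by auto
    qed
  qed
  then obtain m :: nat and b :: "nat \<Rightarrow> nat \<Rightarrow> 'k"
    where mb: "(\<forall>i<m. b i \<longlonglongrightarrow> 0) \<and> (\<forall>x\<in>seq.span B. \<forall>n. x n = (\<Sum>i<m. x i * b i n))"
    by (elim exE that)
  have b0: "b i \<longlonglongrightarrow> 0" if "i < m" for i
    using conjunct1[OF mb] that by simp
  have b: "x n = (\<Sum>i<m. x i * b i n)" if "x \<in> F" for x n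
    using bspec[OF conjunct2[OF mb] that[unfolded B(2)]] by (rule spec)
  have "(\<lambda>n. \<Sum>i<m. norm (b i n)) \<longlonglongrightarrow> (\<Sum>i<m. norm (0::'k))"
    by (intro tendsto_intros b0) auto
  then have "eventually (\<lambda>n. (\<Sum>i<m. norm (b i n)) < 1) sequentially"
    by (rule order_tendstoD(2)) simp
  then obtain s where s: "\<forall>n\<ge>s. (\<Sum>i<m. norm (b i n)) < 1"
    unfolding eventually_sequentially by (elim exE)
  have "\<exists>i<Suc (max m s). norm (x n) \<le> norm (x i)" if x: "x \<in> F" for x n
  proof (cases "n < s")
    case True
    then show ?thesis by (intro exI[of _ n]) simp
  next
    case False
    define M where "M = Max ((\<lambda>i. norm (x i)) ` {..<Suc (max m s)})"
    have M: "norm (x i) \<le> M" if "i < Suc (max m s)" for i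
      unfolding M_def using that by (intro Max_ge) auto
    have "norm (x 0) \<le> M" by (rule M) simp
    with norm_ge_zero[of "x 0"] have M0: "0 \<le> M" by linarith
    have "norm (x n) = norm (\<Sum>i<m. x i * b i n)" by (rule arg_cong[OF b[OF x]])
    also have "\<dots> \<le> (\<Sum>i<m. M * norm (b i n))"
      by (intro sum_norm_le) (auto simp: norm_mult intro!: mult_right_mono M)
    also have "\<dots> \<le> M * 1"
      unfolding sum_distrib_left[symmetric]
    proof (rule mult_left_mono[OF _ M0])
      show "(\<Sum>i<m. norm (b i n)) \<le> 1" using s False by (simp add: less_imp_le)
    qed
    finally have "norm (x n) \<le> M" by simp
    moreover have "M \<in> (\<lambda>i. norm (x i)) ` {..<Suc (max m s)}"
      unfolding M_def by (rule Max_in) auto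
    ultimately show ?thesis by auto
  qed
  then have "\<forall>x\<in>F. \<forall>n. \<exists>i<Suc (max m s). norm (x n) \<le> norm (x i)" by simp
  then show ?thesis by (rule exI)
qed

lemma c0_norm_eq_of_max:
  fixes x :: "nat \<Rightarrow> 'k::real_normed_field"
  assumes "\<forall>n. norm (x n) \<le> norm (x i)"
  shows "ns_norm c0_space x = norm (x i)"
proof -
  have "(SUP n. norm (x n)) = norm (x i)"
    by (rule cSup_eq_maximum) (use assms in auto)
  then show ?thesis by (simp add: c0_space_def)
qed

lemma initial_maximal_index:
  fixes x :: "nat \<Rightarrow> 'k::real_normed_field"
  assumes early: "\<forall>n. \<exists>i<m. norm (x n) \<le> norm (x i)"
  obtains i where "i < m" and "\<forall>n. norm (x n) \<le> norm (x i)"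
proof -
  obtain i0 where "i0 < m" using early by blast
  then have ne: "(\<lambda>i. norm (x i)) ` {..<m} \<noteq> {}" by auto
  have "Max ((\<lambda>i. norm (x i)) ` {..<m}) \<in> (\<lambda>i. norm (x i)) ` {..<m}"
    using ne by (intro Max_in) auto
  then obtain i where i: "i < m" "norm (x i) = Max ((\<lambda>i. norm (x i)) ` {..<m})" by auto
  have "norm (x n) \<le> norm (x i)" for n
  proof -
    obtain k where "k < m" "norm (x n) \<le> norm (x k)" using early by blast
    moreover from this have "norm (x k) \<le> norm (x i)" unfolding i(2) by (intro Max_ge) auto
    ultimately show ?thesis by simp
  qed
  then show thesis using that[OF i(1)] by simp
qed

section \<open>Estimates for the James norm\<close>

text \<open>
  The function \<open>\<phi>\<close> is a time change: along any partition the \<open>p\<close>-th powers of the increments of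
  \<open>h\<close> are bounded by \<open>A\<^sup>p\<close> times increments of \<open>\<phi>\<close>, which telescope to at most \<open>1\<close>.
\<close>

lemma james_enorm_le_of_hoelder:
  fixes h :: "nat \<Rightarrow> 'k::real_normed_field"
  assumes "1 < p" "0 \<le> A" and \<phi>: "\<And>n. 0 \<le> \<phi> n" "\<And>n. \<phi> n \<le> 1"
    and h: "\<And>n k. n \<le> k \<Longrightarrow> \<phi> n \<le> \<phi> k \<and> norm (h n - h k) \<le> A * (\<phi> k - \<phi> n) powr (1 / p)"
  shows "james_enorm p h \<le> ennreal A"
  unfolding james_enorm_def
proof (rule Sup_least, clarify)
  fix k :: nat and n :: "nat \<Rightarrow> nat"
  assume k: "1 \<le> k" and n: "strict_mono_on {1..k + 1} n"
  have step: "norm (h (n j) - h (n (j + 1))) powr p \<le> A powr p * (\<phi> (n (j + 1)) - \<phi> (n j))"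
    if "j \<in> {1..k}" for j
  proof -
    have le: "n j \<le> n (j + 1)"
      using that strict_mono_onD[OF n, of j "j + 1"] by auto
    have "norm (h (n j) - h (n (j + 1))) powr p
        \<le> (A * (\<phi> (n (j + 1)) - \<phi> (n j)) powr (1 / p)) powr p"
      using h[OF le] assms(1) by (intro powr_mono2) auto
    also have "\<dots> = A powr p * (\<phi> (n (j + 1)) - \<phi> (n j))"
      using h[OF le] assms(1,2) by (simp add: powr_mult powr_powr)
    finally show ?thesis .
  qed
  have tel: "(\<Sum>j = 1..k. \<phi> (n (j + 1)) - \<phi> (n j)) = \<phi> (n (k + 1)) - \<phi> (n 1)"
    using sum_Suc_diff[of 1 k "\<lambda>j. \<phi> (n j)"] by simp
  have "(\<Sum>j = 1..k. norm (h (n j) - h (n (j + 1))) powr p)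
      \<le> (\<Sum>j = 1..k. A powr p * (\<phi> (n (j + 1)) - \<phi> (n j)))"
    by (intro sum_mono step)
  also have "\<dots> = A powr p * (\<phi> (n (k + 1)) - \<phi> (n 1))"
    by (simp add: sum_distrib_left[symmetric] tel[simplified])
  also have "\<dots> \<le> A powr p * 1"
    using \<phi>(1)[of "n 1"] \<phi>(2)[of "n (k + 1)"] by (intro mult_left_mono) auto
  finally have "(\<Sum>j = 1..k. norm (h (n j) - h (n (j + 1))) powr p) powr (1 / p)
      \<le> (A powr p) powr (1 / p)"
    using assms(1) by (intro powr_mono2) (auto intro: sum_nonneg)
  also have "\<dots> = A" using assms(1,2) by (simp add: powr_powr)
  finally show "ennreal ((\<Sum>j = 1..k. norm (h (n j) - h (n (j + 1))) powr p) powr (1 / p))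
      \<le> ennreal A"
    by (rule ennreal_leI)
qed

lemma james_enorm_ge_equal_steps:
  fixes h :: "nat \<Rightarrow> 'k::real_normed_field"
  assumes "1 < p" "0 \<le> c" "0 < L" "0 < K"
    and h: "\<And>j. j < K \<Longrightarrow> c * (1 / real K) powr (1 / p) \<le> norm (h (j * L) - h (Suc j * L))"
  shows "ennreal c \<le> james_enorm p h"
proof -
  \<comment> \<open>The shift by one is there because partitions are indexed from \<open>1\<close>.\<close>
  define n where "n j = (j - 1) * L" for j :: nat
  have n: "strict_mono_on {1..K + 1} n"
    using assms(3) by (auto simp: n_def strict_mono_on_def)
  have step: "c powr p * (1 / real K) \<le> norm (h (n j) - h (n (j + 1))) powr p"
    if "j \<in> {1..K}" for j
  proof -
    have "c * (1 / real K) powr (1 / p) \<le> norm (h (n j) - h (n (j + 1)))"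
      using that h[of "j - 1"] assms(4) by (auto simp: n_def)
    then have "(c * (1 / real K) powr (1 / p)) powr p \<le> norm (h (n j) - h (n (j + 1))) powr p"
      using assms by (intro powr_mono2) auto
    then show ?thesis using assms by (simp add: powr_mult powr_powr)
  qed
  have "c powr p = (\<Sum>j = 1..K. c powr p * (1 / real K))" using assms(4) by simp
  also have "\<dots> \<le> (\<Sum>j = 1..K. norm (h (n j) - h (n (j + 1))) powr p)"
    by (intro sum_mono step)
  finally have "(c powr p) powr (1 / p)
      \<le> (\<Sum>j = 1..K. norm (h (n j) - h (n (j + 1))) powr p) powr (1 / p)"
    using assms(1) by (intro powr_mono2) auto
  then have "ennreal c
      \<le> ennreal ((\<Sum>j = 1..K. norm (h (n j) - h (n (j + 1))) powr p) powr (1 / p))"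
    using assms(1,2) by (intro ennreal_leI) (simp add: powr_powr)
  also have "\<dots> \<le> james_enorm p h"
    unfolding james_enorm_def using n assms(4)
    by (intro Sup_upper CollectI exI[of _ K] exI[of _ n] conjI refl) auto
  finally show ?thesis .
qed

section \<open>Almost isometric families of triangle waves\<close>

text \<open>
  The terms grow geometrically with ratio \<open>1/r\<close> up to the index where \<open>w r\<^sup>i\<close> passes \<open>1\<close> and decay
  with ratio \<open>r\<close> after it. With \<open>y \<ge> 1 \<ge> y r\<close> for the value \<open>y = w r\<^sup>i\<close> before the passage, the sum
  is at most \<open>(1/y + y r) / (1 - r)\<close>, and \<open>1/y + y r \<le> 1 + r\<close> since \<open>(y - 1) (1 - y r) \<ge> 0\<close>.
\<close>

lemma sum_two_sided_geometric_le:
  fixes r w :: real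
  assumes "0 < r" "r < 1" "1 \<le> w"
  shows "(\<Sum>i<m. min (w * r ^ i) (1 / (w * r ^ i))) \<le> (1 + r) / (1 - r)"
proof -
  \<comment> \<open>The extra term is the sum of \<open>1 / (w r\<^sup>i)\<close> over all \<open>i < 0\<close>;\<close>
  \<comment> \<open>it makes the claim invariant under the shift \<open>w \<mapsto> w r\<close>.\<close>
  have "(\<Sum>i<m. min (w * r ^ i) (1 / (w * r ^ i))) + r / (1 - r) / w \<le> (1 + r) / (1 - r)"
    using \<open>1 \<le> w\<close>
  proof (induction m arbitrary: w)
    case 0
    have "r / w \<le> 1 + r"
      using divide_left_mono[of 1 w r] 0 assms by simp
    then show ?case using assms divide_right_mono[of "r / w" "1 + r" "1 - r"]
      by (simp add: mult.commute)
  next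
    case (Suc m)
    have w: "0 < w" using Suc.prems by simp
    have "(\<Sum>i<Suc m. min (w * r ^ i) (1 / (w * r ^ i)))
        = min w (1 / w) + (\<Sum>i<m. min ((w * r) * r ^ i) (1 / ((w * r) * r ^ i)))"
      by (subst sum.lessThan_Suc_shift) (simp add: mult_ac)
    moreover have "min w (1 / w) = 1 / w"
    proof -
      have "1 / w \<le> 1" using Suc.prems by simp
      then show ?thesis using Suc.prems by linarith
    qed
    moreover have "1 / w + r / (1 - r) / w = r / (1 - r) / (w * r)"
    proof -
      have "1 + r / (1 - r) = 1 / (1 - r)" using assms by (simp add: divide_simps)
      then have "1 / w + r / (1 - r) / w = 1 / (1 - r) / w"
        by (simp only: add_divide_distrib[symmetric])
      then show ?thesis using assms by simp
    qed
    ultimately have eq: "(\<Sum>i<Suc m. min (w * r ^ i) (1 / (w * r ^ i))) + r / (1 - r) / w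
        = (\<Sum>i<m. min ((w * r) * r ^ i) (1 / ((w * r) * r ^ i))) + r / (1 - r) / (w * r)"
      by simp
    show ?case
    proof (cases "1 \<le> w * r")
      case True
      then show ?thesis using Suc.IH[of "w * r"] eq by simp
    next
      case False
      have "(\<Sum>i<m. min ((w * r) * r ^ i) (1 / ((w * r) * r ^ i))) \<le> (\<Sum>i<m. (w * r) * r ^ i)"
        by (intro sum_mono) auto
      also have "\<dots> = (w * r) * (1 - r ^ m) / (1 - r)"
        using assms by (simp add: sum_distrib_left[symmetric] sum_gp_strict)
      also have "\<dots> \<le> (w * r) / (1 - r)"
        using assms w by (intro divide_right_mono) (auto intro: mult_left_le)
      finally have "(\<Sum>i<m. min ((w * r) * r ^ i) (1 / ((w * r) * r ^ i))) + r / (1 - r) / (w * r)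
          \<le> w * r / (1 - r) + r / (1 - r) / (w * r)"
        by (rule add_right_mono)
      also have e: "r / (1 - r) / (w * r) = 1 / w / (1 - r)" using assms by simp
      also have "w * r / (1 - r) + 1 / w / (1 - r) = (w * r + 1 / w) / (1 - r)"
        by (rule add_divide_distrib[symmetric])
      also have "(w * r + 1 / w) / (1 - r) \<le> (1 + r) / (1 - r)"
      proof (intro divide_right_mono)
        have "0 \<le> (w - 1) * (1 - w * r) / w"
          using False Suc.prems by (intro divide_nonneg_pos mult_nonneg_nonneg) auto
        also have "\<dots> = 1 + r - (w * r + 1 / w)"
          using w by (simp add: field_simps)
        finally show "w * r + 1 / w \<le> 1 + r" by simp
      qed (use assms in auto)
      finally show ?thesis unfolding eq e .
    qed
  qed
  moreover have "0 \<le> r / (1 - r) / w" using assms by simp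
  ultimately show ?thesis by linarith
qed

text \<open>
  The distance from \<open>n\<close> to the nearest multiple of \<open>2 L\<close>.
\<close>

definition triangle_wave :: "nat \<Rightarrow> nat \<Rightarrow> int" where
  "triangle_wave L n = min (int (n mod (2 * L))) (2 * int L - int (n mod (2 * L)))"

lemma triangle_wave_bounds:
  assumes "0 < L"
  shows "0 \<le> triangle_wave L n" "triangle_wave L n \<le> int L"
proof -
  have "n mod (2 * L) < 2 * L" using assms by simp
  then show "0 \<le> triangle_wave L n" "triangle_wave L n \<le> int L"
    unfolding triangle_wave_def by linarith+
qed

lemma triangle_wave_lipschitz:
  assumes "0 < L"
  shows "\<bar>triangle_wave L (n + d) - triangle_wave L n\<bar> \<le> int d"
proof (induction d)
  case (Suc d)
  define s where "s = (n + d) mod (2 * L)"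
  have s: "s < 2 * L" using assms by (simp add: s_def)
  have next_s: "(n + Suc d) mod (2 * L) = (if Suc s = 2 * L then 0 else Suc s)"
    by (simp only: s_def mod_Suc add_Suc_right)
  have "\<bar>min (int (if Suc s = 2 * L then 0 else Suc s)) (2 * int L - int (if Suc s = 2 * L then 0 else Suc s))
      - min (int s) (2 * int L - int s)\<bar> \<le> 1"
  proof (cases "Suc s = 2 * L")
    case True
    then have "int s = 2 * int L - 1" by linarith
    with assms show ?thesis unfolding if_P[OF True] by simp
  next
    case False
    have "int (Suc s) = int s + 1" by simp
    then show ?thesis unfolding if_not_P[OF False] by linarith
  qed
  then have "\<bar>triangle_wave L (n + Suc d) - triangle_wave L (n + d)\<bar> \<le> 1"
    unfolding triangle_wave_def next_s s_def[symmetric] .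
  with Suc show ?case by simp
qed simp

lemma triangle_wave_multiple:
  assumes "0 < L"
  shows "triangle_wave L (j * L) = (if even j then 0 else int L)"
proof -
  have "(j * L) mod (2 * L) = (j mod 2) * L" by (rule mod_mult_mult2)
  moreover have "j mod 2 = (if even j then 0 else 1)" by presburger
  ultimately have "(j * L) mod (2 * L) = (if even j then 0 else L)" by simp
  then show ?thesis unfolding triangle_wave_def by (simp only:) simp
qed

text \<open>
  The argument is cut off at \<open>N\<close>. Thus the sequence is constant from \<open>N\<close> on; it vanishes there if
  \<open>2 L\<close> divides \<open>N\<close>.
\<close>

definition scaled_wave :: "real \<Rightarrow> nat \<Rightarrow> nat \<Rightarrow> nat \<Rightarrow> real" where
  "scaled_wave p N L n =
     (real L / real N) powr (1 / p) * (of_int (triangle_wave L (min n N)) / real L)"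

text \<open>
  The increment of a triangle wave over a distance \<open>d\<close> is at most \<open>d\<close> (by the slope) and at most
  \<open>L\<close> (by the height). After scaling, these bounds carry the factors \<open>t\<^sup>1\<^sup>-\<^sup>1\<^sup>/\<^sup>p\<close> and \<open>t\<^sup>-\<^sup>1\<^sup>/\<^sup>p\<close> with
  \<open>t = d/L\<close>. The common exponent \<open>\<gamma>\<close> makes them symmetric, as \<open>sum_two_sided_geometric_le\<close> needs.
\<close>

lemma scaled_wave_increment_le:
  assumes "0 < L" "0 < N" "0 < \<gamma>" "\<gamma> \<le> 1 / p" "\<gamma> \<le> 1 - 1 / p"
    and "n \<le> k" and d: "d = min k N - min n N" "0 < d"
  shows "\<bar>scaled_wave p N L n - scaled_wave p N L k\<bar>
    \<le> (real d / real N) powr (1 / p)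
        * min ((real d / real L) powr \<gamma>) (1 / (real d / real L) powr \<gamma>)"
proof -
  define t where "t = real d / real L"
  have t: "0 < t" using assms by (simp add: t_def)
  define D where "D = \<bar>triangle_wave L (min k N) - triangle_wave L (min n N)\<bar>"
  have k: "min k N = min n N + d" using assms by auto
  have "D \<le> int d" unfolding D_def k by (rule triangle_wave_lipschitz[OF assms(1)])
  moreover have "D \<le> int L"
    using triangle_wave_bounds[OF assms(1), of "min k N"]
      triangle_wave_bounds[OF assms(1), of "min n N"] by (auto simp: D_def)
  ultimately have D: "of_int D / real L \<le> t" "of_int D / real L \<le> 1"
    using assms(1) by (auto simp: t_def field_simps)
  have min: "(1 / t) powr (1 / p) * min t 1 \<le> min (t powr \<gamma>) (1 / t powr \<gamma>)"
  proof (cases "t \<le> 1")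
    case True
    have "(1 / t) powr (1 / p) * t = t powr (1 - 1 / p)"
      using t by (simp add: powr_divide powr_diff)
    also have "\<dots> \<le> t powr \<gamma>" using True t assms by (intro powr_mono') auto
    finally have "(1 / t) powr (1 / p) * t \<le> t powr \<gamma>" .
    moreover have "t powr \<gamma> \<le> 1" using True t assms(3) by (intro powr_le1) auto
    moreover from this have "1 \<le> 1 / t powr \<gamma>"
      using t by (subst le_divide_eq_1_pos) auto
    ultimately show ?thesis unfolding min_absorb1[OF True]
      by (intro min.boundedI) linarith+
  next
    case False
    have "(1 / t) powr (1 / p) = t powr (- (1 / p))"
      using t by (simp add: powr_divide powr_minus_divide)
    also have "\<dots> \<le> t powr (- \<gamma>)" using False assms by (intro powr_mono) auto
    also have "\<dots> = 1 / t powr \<gamma>" by (simp add: powr_minus_divide)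
    finally have "(1 / t) powr (1 / p) \<le> 1 / t powr \<gamma>" .
    moreover have "1 \<le> t powr \<gamma>" using False assms by (intro ge_one_powr_ge_zero) auto
    moreover have "1 / t powr \<gamma> \<le> 1"
      using t calculation(2) by (subst divide_le_eq_1_pos) auto
    moreover have "min t 1 = 1" using False by simp
    ultimately show ?thesis by (simp only: mult_1_right)
  qed
  have "\<bar>scaled_wave p N L n - scaled_wave p N L k\<bar>
      = (real L / real N) powr (1 / p) * (of_int D / real L)"
    unfolding scaled_wave_def D_def right_diff_distrib[symmetric] diff_divide_distrib[symmetric]
      abs_mult
    by (simp add: abs_minus_commute)
  also have "\<dots> \<le> (real L / real N) powr (1 / p) * min t 1"
    using D by (intro mult_left_mono) auto
  also have "real L / real N = (real d / real N) * (1 / t)"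
    using assms(1,2) d(2) by (simp add: t_def)
  also have "((real d / real N) * (1 / t)) powr (1 / p) * min t 1
      = (real d / real N) powr (1 / p) * ((1 / t) powr (1 / p) * min t 1)"
    using t by (simp add: powr_mult powr_divide)
  also have "\<dots> \<le> (real d / real N) powr (1 / p) * min (t powr \<gamma>) (1 / t powr \<gamma>)"
    by (intro mult_left_mono min) auto
  finally show ?thesis by (simp add: t_def)
qed

lemma scaled_wave_increment_at_nodes:
  assumes "0 < L" "Suc j * L \<le> N"
  shows "\<bar>scaled_wave p N L (j * L) - scaled_wave p N L (Suc j * L)\<bar> = (real L / real N) powr (1 / p)"
proof -
  have "min (j * L) N = j * L" "min (Suc j * L) N = Suc j * L" using assms by auto
  then show ?thesis using assms(1)
    unfolding scaled_wave_def by (simp only: triangle_wave_multiple) simp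
qed

text \<open>
  For the half periods \<open>q\<^sup>i\<close> the bounds of \<open>scaled_wave_increment_le\<close> form a two-sided geometric
  series with ratio \<open>r = q\<^sup>-\<^sup>\<gamma>\<close>, so that their sum is close to \<open>1\<close> uniformly in the distance.
\<close>

lemma lacunary_waves_hoelder:
  fixes q m :: nat and p \<gamma> :: real
  assumes "2 \<le> q" "0 < \<gamma>" "\<gamma> \<le> 1 / p" "\<gamma> \<le> 1 - 1 / p" "n \<le> k"
    and r: "r = 1 / real q powr \<gamma>"
  shows "(\<Sum>i<m. \<bar>scaled_wave p (q ^ m) (q ^ i) n - scaled_wave p (q ^ m) (q ^ i) k\<bar>)
     \<le> (1 + r) / (1 - r) * (real (min k (q ^ m) - min n (q ^ m)) / real (q ^ m)) powr (1 / p)"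
proof -
  define d where "d = min k (q ^ m) - min n (q ^ m)"
  show ?thesis
  proof (cases "d = 0")
    case True
    then have "min k (q ^ m) = min n (q ^ m)" using assms(5) by (auto simp: d_def)
    then show ?thesis by (simp add: scaled_wave_def)
  next
    case False
    have q: "1 < real q powr \<gamma>" using assms by (intro gr_one_powr) auto
    then have r01: "0 < r" "r < 1" using assms(1) by (auto simp: r divide_less_eq)
    have w: "1 \<le> real d powr \<gamma>" using False assms by (intro ge_one_powr_ge_zero) auto
    have rew: "(real d / real (q ^ i)) powr \<gamma> = real d powr \<gamma> * r ^ i" for i
      using assms(1) by (simp add: r powr_divide powr_powr powr_power[symmetric] field_simps powr_realpow[symmetric])
    have "(\<Sum>i<m. \<bar>scaled_wave p (q ^ m) (q ^ i) n - scaled_wave p (q ^ m) (q ^ i) k\<bar>)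
        \<le> (\<Sum>i<m. (real d / real (q ^ m)) powr (1 / p)
            * min (real d powr \<gamma> * r ^ i) (1 / (real d powr \<gamma> * r ^ i)))"
      unfolding rew[symmetric] using assms False
      by (intro sum_mono scaled_wave_increment_le) (auto simp: d_def)
    also have "\<dots> \<le> (real d / real (q ^ m)) powr (1 / p) * ((1 + r) / (1 - r))"
      unfolding sum_distrib_left[symmetric]
      by (intro mult_left_mono sum_two_sided_geometric_le r01 w) auto
    finally show ?thesis by (simp add: d_def mult.commute)
  qed
qed

text \<open>
  The last property provides, for each wave, a partition of \<open>{0..N}\<close> along which its \<open>p\<close>-variation
  is exactly \<open>1\<close>. Together with the Hoelder bound it implies that at the steps of this partition the
  increments of all other waves add up to at most \<open>\<epsilon>\<close> times the increment of that wave.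
\<close>

lemma exists_almost_isometric_waves:
  fixes p \<epsilon> :: real and m :: nat
  assumes "1 < p" "0 < \<epsilon>"
  obtains u :: "nat \<Rightarrow> nat \<Rightarrow> real" and N :: nat
  where "0 < N" and "\<And>i n. i < m \<Longrightarrow> N \<le> n \<Longrightarrow> u i n = 0"
    and "\<And>n k. n \<le> k \<Longrightarrow> (\<Sum>i<m. \<bar>u i n - u i k\<bar>)
        \<le> (1 + \<epsilon>) * (real (min k N) / real N - real (min n N) / real N) powr (1 / p)"
    and "\<And>i. i < m \<Longrightarrow> \<exists>L K. 0 < L \<and> 0 < K \<and> N = K * L \<and>
        (\<forall>j<K. \<bar>u i (j * L) - u i (Suc j * L)\<bar> = (1 / real K) powr (1 / p))"
proof -
  define \<gamma> where "\<gamma> = min (1 / p) (1 - 1 / p)"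
  have \<gamma>: "0 < \<gamma>" "\<gamma> \<le> 1 / p" "\<gamma> \<le> 1 - 1 / p" using assms by (auto simp: \<gamma>_def)
  \<comment> \<open>With \<open>r \<le> 1/C\<close> both \<open>r \<le> 1/2\<close> and \<open>4 r \<le> \<epsilon>\<close>, and so \<open>2 r / (1 - r) \<le> \<epsilon>\<close>.\<close>
  define C where "C = 2 + 4 / \<epsilon>"
  obtain a :: nat where a: "max 1 (C powr (1 / \<gamma>)) \<le> real a" using real_arch_simple by blast
  \<comment> \<open>\<open>q\<close> is even so that \<open>N\<close> is a multiple of each period \<open>2 q\<^sup>i\<close> and all waves end at \<open>0\<close>.\<close>
  define q where "q = 2 * a"
  have q2: "2 \<le> q" using a by (simp add: q_def)
  define r where "r = 1 / real q powr \<gamma>"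
  have C: "2 < C" using assms by (simp add: C_def)
  have "C = (C powr (1 / \<gamma>)) powr \<gamma>" using \<gamma> C by (simp add: powr_powr)
  also have "\<dots> \<le> real q powr \<gamma>" using a \<gamma> by (intro powr_mono2) (auto simp: q_def)
  finally have Cq: "C \<le> real q powr \<gamma>" .
  have r: "(1 + r) / (1 - r) \<le> 1 + \<epsilon>"
  proof -
    have r0: "0 < r" "r \<le> 1 / C"
      using Cq C q2 by (auto simp: r_def intro!: divide_left_mono mult_pos_pos)
    then have "r * C \<le> 1" using C by (simp add: le_divide_eq)
    then have *: "r * 2 + 4 * r / \<epsilon> \<le> 1" by (simp add: C_def algebra_simps)
    have p4: "0 \<le> 4 * r / \<epsilon>" using r0 assms by simp
    have "4 * r / \<epsilon> \<le> 1" using * r0 by linarith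
    then have "4 * r \<le> \<epsilon>" using assms by (simp add: divide_le_eq)
    moreover have "r \<le> 1 / 2" using * p4 by linarith
    ultimately have "2 * r \<le> \<epsilon> * (1 - r)"
      using mult_left_mono[of "1 / 2" "1 - r" \<epsilon>] assms by linarith
    then show ?thesis using \<open>r \<le> 1 / 2\<close> by (simp add: divide_le_eq algebra_simps)
  qed
  define N where "N = q ^ m"
  define u where "u i = scaled_wave p N (q ^ i)" for i
  have N: "0 < N" using q2 by (simp add: N_def)
  have split: "N = q ^ (m - i) * q ^ i" if "i < m" for i
    using that by (simp add: N_def power_add[symmetric])
  have zero: "u i n = 0" if i: "i < m" and n: "N \<le> n" for i n
  proof -
    have "even (q ^ (m - i))" using i by (simp add: q_def)
    then have "triangle_wave (q ^ i) N = 0"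
      unfolding split[OF i] using q2 by (subst triangle_wave_multiple) auto
    then show ?thesis using n by (simp add: u_def scaled_wave_def min_def)
  qed
  have hoelder: "(\<Sum>i<m. \<bar>u i n - u i k\<bar>)
      \<le> (1 + \<epsilon>) * (real (min k N) / real N - real (min n N) / real N) powr (1 / p)"
    if nk: "n \<le> k" for n k
  proof -
    have "(\<Sum>i<m. \<bar>u i n - u i k\<bar>)
        \<le> (1 + r) / (1 - r) * (real (min k N - min n N) / real N) powr (1 / p)"
      unfolding u_def N_def by (rule lacunary_waves_hoelder[OF q2 \<gamma> nk r_def])
    also have "\<dots> \<le> (1 + \<epsilon>) * (real (min k N - min n N) / real N) powr (1 / p)"
      by (intro mult_right_mono r) auto
    also have "real (min k N - min n N) / real N = real (min k N) / real N - real (min n N) / real N"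
      using nk by (subst of_nat_diff) (auto simp: diff_divide_distrib)
    finally show ?thesis .
  qed
  have nodes: "\<bar>u i (j * q ^ i) - u i (Suc j * q ^ i)\<bar> = (1 / real (q ^ (m - i))) powr (1 / p)"
    if i: "i < m" and j: "j < q ^ (m - i)" for i j
  proof -
    have "Suc j * q ^ i \<le> N" unfolding split[OF i] using j by (intro mult_right_mono) auto
    then have "\<bar>u i (j * q ^ i) - u i (Suc j * q ^ i)\<bar> = (real (q ^ i) / real N) powr (1 / p)"
      unfolding u_def using q2 by (intro scaled_wave_increment_at_nodes) auto
    also have "real (q ^ i) / real N = 1 / real (q ^ (m - i))"
      unfolding split[OF i] using q2 by simp
    finally show ?thesis .
  qed
  have "\<exists>L K. 0 < L \<and> 0 < K \<and> N = K * L \<and>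
        (\<forall>j<K. \<bar>u i (j * L) - u i (Suc j * L)\<bar> = (1 / real K) powr (1 / p))" if i: "i < m" for i
    using q2 split[OF i] nodes[OF i] by (intro exI[of _ "q ^ i"] exI[of _ "q ^ (m - i)"]) auto
  with N zero hoelder show thesis by (rule that)
qed

section \<open>Finite representability\<close>

text \<open>
  The map that sends \<open>x\<close> to its first \<open>m\<close> terms is isometric on \<open>F\<close> for the maximum norm. The waves
  are real, so that the scalars can be taken from any normed field that contains the reals.
\<close>

theorem c0_finitely_representable_james:
  assumes "1 < p"
  shows "finitely_representable (c0_space :: ('k::real_normed_field, nat \<Rightarrow> 'k) nspace)
           (james_space p)"
  unfolding finitely_representable_def
proof (intro allI impI, elim conjE)
  fix F :: "(nat \<Rightarrow> 'k) set" and \<epsilon> :: real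
  assume F: "findim_subspace c0_space F" and \<epsilon>: "0 < \<epsilon>"
  obtain m where m: "\<forall>x\<in>F. \<forall>n. \<exists>i<m. norm (x n) \<le> norm (x i)"
    using findim_c0_sup_attained_early[OF F] by (elim exE)
  show "\<exists>T. linear_operator_on F c0_space (james_space p) T \<and>
      (\<forall>x\<in>F. (1 - \<epsilon>) * ns_norm c0_space x \<le> ns_norm (james_space p) (T x) \<and>
             ns_norm (james_space p) (T x) \<le> (1 + \<epsilon>) * ns_norm c0_space x)"
  proof (rule exists_almost_isometric_waves[OF assms \<epsilon>, of m])
    fix u :: "nat \<Rightarrow> nat \<Rightarrow> real" and N :: nat
    assume N: "0 < N" and zero: "\<And>i n. i < m \<Longrightarrow> N \<le> n \<Longrightarrow> u i n = (0::real)"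
      and hoelder: "\<And>n k. n \<le> k \<Longrightarrow> (\<Sum>i<m. \<bar>u i n - u i k\<bar>)
          \<le> (1 + \<epsilon>) * (real (min k N) / real N - real (min n N) / real N) powr (1 / p)"
      and nodes: "\<And>i. i < m \<Longrightarrow> \<exists>L K. 0 < L \<and> 0 < K \<and> N = K * L \<and>
          (\<forall>j<K. \<bar>u i (j * L) - u i (Suc j * L)\<bar> = (1 / real K) powr (1 / p))"
    define T where "T x n = (\<Sum>i<m. x i * of_real (u i n))" for x :: "nat \<Rightarrow> 'k" and n
    have norm_T: "(1 - \<epsilon>) * ns_norm c0_space x \<le> enn2real (james_enorm p (T x)) \<and>
        enn2real (james_enorm p (T x)) \<le> (1 + \<epsilon>) * ns_norm c0_space x \<and> james_enorm p (T x) < \<infinity>"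
      if x: "x \<in> F" for x
    proof -
      obtain i where i: "i < m" and max: "\<forall>n. norm (x n) \<le> norm (x i)"
        by (rule initial_maximal_index[OF bspec[OF m x]])
      define M where "M = norm (x i)"
      have M: "ns_norm c0_space x = M" unfolding M_def by (rule c0_norm_eq_of_max[OF max])
      have M0: "0 \<le> M" by (simp add: M_def)
      have diff: "T x n - T x k = (\<Sum>i<m. x i * of_real (u i n - u i k))" for n k
        by (simp add: T_def sum_subtractf algebra_simps)
      have upper: "norm (T x n - T x k)
          \<le> M * (1 + \<epsilon>) * (real (min k N) / real N - real (min n N) / real N) powr (1 / p)"
        if "n \<le> k" for n k
      proof -
        have "norm (T x n - T x k) \<le> (\<Sum>i<m. M * \<bar>u i n - u i k\<bar>)"
          unfolding diff
          by (intro sum_norm_le) (auto simp: norm_mult M_def simp del: of_real_diff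
              intro!: mult_right_mono spec[OF max])
        also have "\<dots> \<le> M * ((1 + \<epsilon>) * (real (min k N) / real N - real (min n N) / real N) powr (1 / p))"
          unfolding sum_distrib_left[symmetric] by (intro mult_left_mono hoelder that M0)
        finally show ?thesis by (simp add: mult.assoc)
      qed
      have le: "james_enorm p (T x) \<le> ennreal (M * (1 + \<epsilon>))"
      proof (rule james_enorm_le_of_hoelder[OF assms])
        show "real (min n N) / real N \<le> real (min k N) / real N \<and>
            norm (T x n - T x k)
            \<le> M * (1 + \<epsilon>) * (real (min k N) / real N - real (min n N) / real N) powr (1 / p)"
          if "n \<le> k" for n k
          using upper[OF that] that by (auto intro!: divide_right_mono)
        show "real (min n N) / real N \<le> 1" "0 \<le> real (min n N) / real N" for n
          using N by (simp_all add: divide_le_eq)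
      qed (use M0 \<epsilon> in simp)
      obtain L K where L: "0 < L" and K: "0 < K" and NKL: "N = K * L"
        and jumps: "\<forall>j<K. \<bar>u i (j * L) - u i (Suc j * L)\<bar> = (1 / real K) powr (1 / p)"
        using nodes[OF i] by (elim exE conjE)
      have lower: "(1 - \<epsilon>) * M * (1 / real K) powr (1 / p) \<le> norm (T x (j * L) - T x (Suc j * L))"
        if j: "j < K" for j
      proof -
        let ?\<Delta> = "\<lambda>l. u l (j * L) - u l (Suc j * L)"
        let ?c = "(1 / real K) powr (1 / p)"
        have jN: "Suc j * L \<le> N" unfolding NKL using j by (intro mult_right_mono) auto
        then have mins: "min (Suc j * L) N = Suc j * L" "min (j * L) N = j * L" by auto
        have len: "real (Suc j * L) / real N - real (j * L) / real N = 1 / real K"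
          using L K by (simp add: NKL field_simps)
        have "(\<Sum>l<m. \<bar>?\<Delta> l\<bar>) \<le> (1 + \<epsilon>) * ?c"
          using hoelder[of "j * L" "Suc j * L"] unfolding mins len by simp
        moreover have "(\<Sum>l<m. \<bar>?\<Delta> l\<bar>) = \<bar>?\<Delta> i\<bar> + (\<Sum>l\<in>{..<m} - {i}. \<bar>?\<Delta> l\<bar>)"
          using i by (intro sum.remove) auto
        ultimately have others: "(\<Sum>l\<in>{..<m} - {i}. \<bar>?\<Delta> l\<bar>) \<le> \<epsilon> * ?c"
          using jumps[rule_format, OF j] by (simp add: algebra_simps)
        let ?R = "\<Sum>l\<in>{..<m} - {i}. x l * of_real (?\<Delta> l)"
        have "norm ?R \<le> (\<Sum>l\<in>{..<m} - {i}. M * \<bar>?\<Delta> l\<bar>)"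
          by (intro sum_norm_le) (auto simp: norm_mult M_def simp del: of_real_diff
              intro!: mult_right_mono spec[OF max])
        also have "\<dots> \<le> M * (\<epsilon> * ?c)"
          unfolding sum_distrib_left[symmetric] by (intro mult_left_mono others M0)
        finally have R: "norm ?R \<le> M * (\<epsilon> * ?c)" .
        have "T x (j * L) - T x (Suc j * L) = x i * of_real (?\<Delta> i) + ?R"
          unfolding diff using i by (intro sum.remove) auto
        then have "norm (x i * of_real (?\<Delta> i)) - norm ?R \<le> norm (T x (j * L) - T x (Suc j * L))"
          by (simp only: norm_diff_ineq)
        moreover have "norm (x i * of_real (?\<Delta> i)) = M * ?c"
          unfolding norm_mult norm_of_real jumps[rule_format, OF j] M_def ..
        ultimately show ?thesis using R by (simp add: algebra_simps)
      qed
      have fin: "james_enorm p (T x) < \<infinity>"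
        using le by (rule order_le_less_trans) simp
      have "enn2real (james_enorm p (T x)) \<le> M * (1 + \<epsilon>)"
        by (rule enn2real_leI[OF _ le]) (use M0 \<epsilon> in simp)
      moreover have "(1 - \<epsilon>) * M \<le> enn2real (james_enorm p (T x))"
      \<comment> \<open>Nothing forces \<open>\<epsilon> \<le> 1\<close>; for larger \<open>\<epsilon>\<close> the lower bound can be negative.\<close>
      proof (cases "0 \<le> (1 - \<epsilon>) * M")
        case True
        have "ennreal ((1 - \<epsilon>) * M) \<le> james_enorm p (T x)"
          using assms True L K lower by (rule james_enorm_ge_equal_steps)
        then have "enn2real (ennreal ((1 - \<epsilon>) * M)) \<le> enn2real (james_enorm p (T x))"
          using fin by (intro enn2real_mono) auto
        then show ?thesis using True by simp
      next
        case False
        then show ?thesis using enn2real_nonneg[of "james_enorm p (T x)"] by linarith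
      qed
      ultimately show ?thesis using fin M by (simp add: mult.commute)
    qed
    have null: "T x \<longlonglongrightarrow> 0" for x
    proof (rule tendsto_eventually)
      show "eventually (\<lambda>n. T x n = 0) sequentially"
        unfolding eventually_sequentially by (intro exI[of _ N]) (auto simp: T_def zero)
    qed
    have "linear_operator_on F c0_space (james_space p) T"
      unfolding linear_operator_on_def
    proof (intro conjI ballI allI)
      show "T x \<in> ns_carrier (james_space p)" if "x \<in> F" for x
        by (simp add: james_space_def c0_space_def null[of x] norm_T[OF that, THEN conjunct2, THEN conjunct2, simplified])
      show "T (x + y) = T x + T y" for x y
        by (rule ext) (simp add: T_def distrib_right sum.distrib)
      show "T (ns_scale c0_space c x) = ns_scale (james_space p) c (T x)" for c x
        by (rule ext)
          (simp add: c0_space_def james_space_def seq_scale_def T_def sum_distrib_left mult.assoc)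
    qed
    moreover have "ns_norm (james_space p) (T x) = enn2real (james_enorm p (T x))" for x
      by (simp add: james_space_def)
    ultimately show ?thesis
      by (intro exI[of _ T] conjI ballI) (simp_all only: norm_T)
  qed
qed

theorem theorem1p1:
  fixes p :: real
  assumes "1 < p"
  shows "finitely_representable (c0_space :: (real, nat \<Rightarrow> real) nspace) (james_space p) \<and>
         finitely_representable (c0_space :: (complex, nat \<Rightarrow> complex) nspace) (james_space p)"
  by (intro conjI c0_finitely_representable_james assms)

end
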